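(* Let $\Omega\subset\mathbb R^d$ be a bounded Lipschitz domain, $\alpha\in(0,1]$, and let $p,q$ be numbers with $1<p\le q<\infty$. Let $p(\cdot),q(\cdot):\overline\Omega\to[1,\infty)$ satisfy $p\le p(x)\le q(x)\le q$ for all $x$, and suppose there are constants $C_p,C_q$ such that for all $x\neq y$ with $|x-y|\le\min(\operatorname{diam}\Omega,\frac12)$ $$|p(x)-p(y)|\le-\frac{C_p}{\log|x-y|},\qquad |q(x)-q(y)|\le-\frac{C_q}{\log|x-y|}.$$ Let $a:\overline\Omega\to[0,\infty)$ belong to $C^\alpha(\overline\Omega)$, and define $\phi(x,\xi)=|\xi|^{p(x)}+a(x)|\xi|^{q(x)}$ for $x\in\overline\Omega$, $\xi\ge0$. If $q\le p+\alpha\max\left(1,\frac pd\right)$, then $\phi$ satisfies the following condition: for all $D>1$ there are constants $M$ and $N$ such that $$\phi(z,\xi)\le M\,\phi(y,\xi)+N$$ for all balls $B_\gamma(x)$, all $y,z\in\overline{B_\gamma(x)}\cap\overline\Omega$, all $\xi\in\left[0,D\gamma^{-\min(1,d/p)}\right]$ and all $\gamma\in\left(0,\frac12\right)$.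
   Context: $B_\gamma(x)$ is the open ball of radius $\gamma$ and center $x$ in $\mathbb R^d$. $C^\alpha(\overline\Omega)$ is the space of Hölder continuous functions with exponent $\alpha$. The constants $M,N$ are independent of $x,y,z,\xi,\gamma$. *)

theory Defs
  imports "HOL-Analysis.Analysis"
begin

text \<open>Near each boundary point the domain is, in rotated Cartesian coordinates, the part of a ball
  lying strictly above the graph of a Lipschitz function.  The unit vector \<open>e\<close> is the
  vertical direction; \<open>x - (x \<bullet> e) *\<^sub>R e\<close> is the projection of \<open>x\<close> to the hyperplane
  orthogonal to \<open>e\<close>, which plays the role of the first \<open>d - 1\<close> coordinates.\<close>

definition lipschitz_domain :: "'a::euclidean_space set \<Rightarrow> bool" where
  "lipschitz_domain \<Omega> \<longleftrightarrow>
     open \<Omega> \<and> connected \<Omega> \<and> \<Omega> \<noteq> {} \<and>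
     (\<forall>x\<^sub>0\<in>frontier \<Omega>. \<exists>e g L r.
        norm e = 1 \<and> r > 0 \<and> L-lipschitz_on {v. v \<bullet> e = 0} (g :: 'a \<Rightarrow> real) \<and>
        \<Omega> \<inter> ball x\<^sub>0 r = {x \<in> ball x\<^sub>0 r. g (x - (x \<bullet> e) *\<^sub>R e) < x \<bullet> e})"

text \<open>No separate boundedness condition: on bounded sets it follows from the Hoelder estimate.\<close>

definition holder_space :: "real \<Rightarrow> 'a::metric_space set \<Rightarrow> ('a \<Rightarrow> real) set" where
  "holder_space \<alpha> S = {f. \<exists>C. \<forall>x\<in>S. \<forall>y\<in>S. \<bar>f x - f y\<bar> \<le> C * dist x y powr \<alpha>}"

definition double_phase ::
    "('a \<Rightarrow> real) \<Rightarrow> ('a \<Rightarrow> real) \<Rightarrow> ('a \<Rightarrow> real) \<Rightarrow> 'a \<Rightarrow> real \<Rightarrow> real" where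
  "double_phase pf qf a x \<xi> = \<bar>\<xi>\<bar> powr pf x + a x * \<bar>\<xi>\<bar> powr qf x"

end

theory Submission
  imports Defs
begin

text \<open>Since \<open>dist y z \<le> 2 * \<gamma>\<close>, the variation of the exponents over the ball costs only the bounded
  factor \<open>\<xi> powr (C / ln (1 / dist y z))\<close>, as \<open>\<xi>\<close> is at most a multiple of \<open>1 / dist y z\<close>.  The variation
  of \<open>a\<close> costs \<open>\<gamma> powr \<alpha> * \<xi> powr (q - p)\<close> relative to the first phase, which the bound on
  \<open>\<xi>\<close> and the relation between \<open>p\<close>, \<open>q\<close> and \<open>\<alpha>\<close> keep bounded.  For \<open>\<xi> \<le> 4 * D\<close>, and so
  whenever \<open>\<gamma> \<ge> 1 / 4\<close>, boundedness of \<open>a\<close> suffices.\<close>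

text \<open>After splitting off \<open>\<xi> powr (s - t)\<close>, everything rests on the bound
  \<open>\<bar>C\<bar> * (ln \<xi> / (- ln r))\<close> for its logarithm. The numerator is at most
  \<open>ln E - ln r\<close> and the denominator is at least \<open>ln 2\<close>, so the two
  logarithms of \<open>r\<close> cancel up to a constant independent of \<open>r\<close> and
  \<open>\<xi>\<close>.\<close>

lemma powr_le_of_log_holder:
  fixes s t C r E \<xi> :: real
  assumes st: "\<bar>s - t\<bar> \<le> - (C / ln r)" and r: "0 < r" "r \<le> 1/2" and E: "1 \<le> E"
    and \<xi>: "1 \<le> \<xi>" "\<xi> \<le> E / r"
  shows "\<xi> powr s \<le> exp (\<bar>C\<bar> * (ln E / ln 2 + 1)) * \<xi> powr t"
proof -
  have E1: "ln \<xi> \<le> ln E - ln r"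
  proof -
    have "ln \<xi> \<le> ln (E / r)" using \<xi> by simp
    also have "\<dots> = ln E - ln r" using E r by (simp add: ln_div)
    finally show ?thesis .
  qed
  have "ln r \<le> ln (1/2)" using r by simp
  then have lr: "ln 2 \<le> - ln r" by (simp add: ln_div)
  have l2: "ln (2::real) > 0" by simp
  have "\<xi> powr s = \<xi> powr (s - t) * \<xi> powr t"
    by (simp flip: powr_add)
  moreover have "\<xi> powr (s - t) \<le> exp (\<bar>C\<bar> * (ln E / ln 2 + 1))"
  proof -
    have "(s - t) * ln \<xi> \<le> \<bar>s - t\<bar> * ln \<xi>"
      using \<xi> by (intro mult_right_mono) auto
    also have "\<dots> \<le> (\<bar>C\<bar> / (- ln r)) * ln \<xi>"
    proof (intro mult_right_mono order.trans[OF st])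
      show "- (C / ln r) \<le> \<bar>C\<bar> / - ln r"
        using divide_right_mono[of C "\<bar>C\<bar>" "- ln r"] lr l2 by simp
    qed (use \<xi> in simp)
    also have "\<dots> = \<bar>C\<bar> * (ln \<xi> / (- ln r))" by simp
    also have "\<dots> \<le> \<bar>C\<bar> * (ln E / ln 2 + 1)"
    proof (intro mult_left_mono)
      have pos: "- ln r > 0" using lr l2 by linarith
      show "ln \<xi> / (- ln r) \<le> ln E / ln 2 + 1"
      proof -
        have "ln \<xi> / (- ln r) \<le> (ln E - ln r) / (- ln r)"
          using E1 pos by (intro divide_right_mono) auto
        also have "\<dots> = ln E / (- ln r) + 1" using pos by (simp add: field_simps)
        also have "ln E / (- ln r) \<le> ln E / ln 2"
          using E lr l2 pos by (intro divide_left_mono mult_pos_pos) auto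
        finally show ?thesis by simp
      qed
    qed simp
    finally show ?thesis using \<xi> by (simp add: powr_def)
  qed
  ultimately show ?thesis by (simp add: mult_right_mono)
qed

text \<open>The definition leaves the sign of the constant open; passing to its absolute value makes
  it usable as a factor in monotonicity arguments.\<close>

lemma holder_space_const:
  assumes "f \<in> holder_space \<alpha> S"
  obtains C where "C \<ge> 0" "\<And>x y. x \<in> S \<Longrightarrow> y \<in> S \<Longrightarrow> \<bar>f x - f y\<bar> \<le> C * dist x y powr \<alpha>"
proof -
  obtain C where C: "\<forall>x\<in>S. \<forall>y\<in>S. \<bar>f x - f y\<bar> \<le> C * dist x y powr \<alpha>"
    using assms by (auto simp: holder_space_def)
  show thesis
  proof (rule that[of "\<bar>C\<bar>"])
    fix x y assume "x \<in> S" "y \<in> S"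
    then have "\<bar>f x - f y\<bar> \<le> C * dist x y powr \<alpha>" using C by blast
    also have "\<dots> \<le> \<bar>C\<bar> * dist x y powr \<alpha>" by (intro mult_right_mono) auto
    finally show "\<bar>f x - f y\<bar> \<le> \<bar>C\<bar> * dist x y powr \<alpha>" .
  qed simp
qed

text \<open>Compare with the value at one fixed point: no distance in the set exceeds its
  diameter.\<close>

lemma holder_space_bounded_above:
  assumes "f \<in> holder_space \<alpha> S" "bounded S" "0 \<le> \<alpha>"
  obtains A where "A \<ge> 0" "\<And>x. x \<in> S \<Longrightarrow> f x \<le> A"
proof (cases "S = {}")
  case True
  then show ?thesis using that[of 0] by simp
next
  case False
  then obtain w where w: "w \<in> S" by blast
  obtain C where C: "C \<ge> 0" "\<And>x y. x \<in> S \<Longrightarrow> y \<in> S \<Longrightarrow> \<bar>f x - f y\<bar> \<le> C * dist x y powr \<alpha>"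
    using holder_space_const[OF assms(1)] by blast
  show ?thesis
  proof (rule that[of "\<bar>f w\<bar> + C * diameter S powr \<alpha>"])
    fix x assume x: "x \<in> S"
    have "dist x w powr \<alpha> \<le> diameter S powr \<alpha>"
      using diameter_bounded_bound[OF assms(2) x w] assms(3) by (intro powr_mono2) auto
    then have "C * dist x w powr \<alpha> \<le> C * diameter S powr \<alpha>"
      using C(1) by (rule mult_left_mono)
    then show "f x \<le> \<bar>f w\<bar> + C * diameter S powr \<alpha>"
      using C(2)[OF x w] by linarith
  qed (use C(1) in simp)
qed

text \<open>The excess power \<open>\<xi> powr (v - u)\<close> grows at most like
  \<open>\<gamma> powr (- \<alpha>)\<close>, and \<open>r powr \<alpha>\<close> is of order
  \<open>\<gamma> powr \<alpha>\<close>, so the two cancel.\<close>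

lemma holder_gap_powr_le:
  fixes \<alpha> \<sigma> D \<gamma> r \<xi> u v :: real
  assumes \<alpha>: "0 \<le> \<alpha>" and \<sigma>: "0 < \<sigma>" and \<gamma>: "0 < \<gamma>" and D: "0 \<le> D"
    and r: "0 \<le> r" "r \<le> 2 * \<gamma>"
    and \<xi>: "1 \<le> \<xi>" "\<xi> \<le> D * \<gamma> powr (- \<sigma>)" and gap: "v - u \<le> \<alpha> / \<sigma>"
  shows "r powr \<alpha> * \<xi> powr v \<le> 2 powr \<alpha> * D powr (\<alpha> / \<sigma>) * \<xi> powr u"
proof -
  \<comment> \<open>As \<open>\<xi>\<close> is at least 1, the exponent may be raised to \<alpha> /
    \<sigma>, which is chosen so that inserting the bound on \<open>\<xi>\<close> yields exactly
    \<open>\<gamma> powr (- \<alpha>)\<close>.\<close>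
  have "\<xi> powr (v - u) \<le> \<xi> powr (\<alpha> / \<sigma>)"
    using \<xi>(1) gap by (intro powr_mono) auto
  also have "\<dots> \<le> (D * \<gamma> powr (- \<sigma>)) powr (\<alpha> / \<sigma>)"
    using \<xi> \<alpha> \<sigma> by (intro powr_mono2) auto
  also have "\<dots> = D powr (\<alpha> / \<sigma>) * \<gamma> powr (- \<alpha>)"
    using D \<sigma> by (simp add: powr_mult powr_powr)
  finally have 1: "\<xi> powr (v - u) \<le> D powr (\<alpha> / \<sigma>) * \<gamma> powr (- \<alpha>)" .
  have 2: "r powr \<alpha> \<le> 2 powr \<alpha> * \<gamma> powr \<alpha>"
    using powr_mono2[OF \<alpha> r] \<gamma> by (simp add: powr_mult)
  have "r powr \<alpha> * \<xi> powr (v - u)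
      \<le> (2 powr \<alpha> * \<gamma> powr \<alpha>) * (D powr (\<alpha> / \<sigma>) * \<gamma> powr (- \<alpha>))"
    using 1 2 by (intro mult_mono) auto
  also have "\<dots> = 2 powr \<alpha> * D powr (\<alpha> / \<sigma>)"
    using \<gamma> by (simp add: powr_minus field_simps)
  finally have "r powr \<alpha> * \<xi> powr (v - u) * \<xi> powr u
      \<le> 2 powr \<alpha> * D powr (\<alpha> / \<sigma>) * \<xi> powr u"
    by (intro mult_right_mono) auto
  moreover have "\<xi> powr v = \<xi> powr (v - u) * \<xi> powr u" by (simp flip: powr_add)
  ultimately show ?thesis by (simp add: mult.assoc)
qed

text \<open>With \<open>B\<close> at least 1, one power \<open>B powr q\<close> dominates both
  phases. This supplies the additive constant for small \<open>\<xi>\<close>.\<close>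

lemma double_phase_le_of_bounded:
  assumes "0 \<le> \<xi>" "\<xi> \<le> B" "1 \<le> B" "0 \<le> pf z" "0 \<le> qf z" "pf z \<le> q" "qf z \<le> q" "0 \<le> a z" "a z \<le> A"
  shows "double_phase pf qf a z \<xi> \<le> (1 + A) * B powr q"
proof -
  have *: "\<xi> powr t \<le> B powr q" if "0 \<le> t" "t \<le> q" for t
    using powr_mono2[of t \<xi> B] powr_mono[of t q B] that assms(1-3) by linarith
  have "a z * \<xi> powr qf z \<le> A * B powr q"
    using assms * by (intro mult_mono) auto
  then show ?thesis
    using *[of "pf z"] assms by (simp add: double_phase_def distrib_right)
qed

text \<open>In the second phase the exponent is moved from \<open>z\<close> to \<open>y\<close>
  first, at cost \<open>L\<close>, and the coefficient afterwards. The error \<open>H * R\<close> of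
  the coefficient then multiplies \<open>\<bar>\<xi>\<bar> powr qf y\<close> and is absorbed into
  the first phase at \<open>y\<close> through \<open>W\<close>, which explains the product
  \<open>L * H * W\<close>.\<close>

lemma double_phase_comparison:
  assumes P: "\<bar>\<xi>\<bar> powr pf z \<le> K * \<bar>\<xi>\<bar> powr pf y" and Q: "\<bar>\<xi>\<bar> powr qf z \<le> L * \<bar>\<xi>\<bar> powr qf y"
    and az: "0 \<le> a z" "a z \<le> a y + H * R" and ay: "0 \<le> a y"
    and R: "R * \<bar>\<xi>\<bar> powr qf y \<le> W * \<bar>\<xi>\<bar> powr pf y"
    and nonneg: "0 \<le> K" "0 \<le> L" "0 \<le> H" "0 \<le> W"
  shows "double_phase pf qf a z \<xi> \<le> (K + L + L * H * W) * double_phase pf qf a y \<xi>"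
proof -
  define u v where "u = \<bar>\<xi>\<bar> powr pf y" and "v = \<bar>\<xi>\<bar> powr qf y"
  have uv: "0 \<le> u" "0 \<le> v" by (simp_all add: u_def v_def)
  have "a z * \<bar>\<xi>\<bar> powr qf z \<le> a z * (L * v)"
    using Q az by (intro mult_left_mono) (auto simp: v_def)
  also have "\<dots> \<le> (a y + H * R) * (L * v)"
    using az uv nonneg by (intro mult_right_mono) auto
  also have "\<dots> = L * (a y * v) + L * H * (R * v)" by (simp add: algebra_simps)
  also have "\<dots> \<le> L * (a y * v) + L * H * (W * u)"
    using R nonneg by (intro add_left_mono mult_left_mono) (auto simp: u_def v_def)
  finally have "double_phase pf qf a z \<xi> \<le> K * u + L * (a y * v) + L * H * (W * u)"
    using P by (simp add: double_phase_def u_def)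
  \<comment> \<open>The right side exceeds the left by three nonnegative cross terms.\<close>
  also have "\<dots> \<le> (K + L + L * H * W) * (u + a y * v)"
  proof -
    have "0 \<le> K * (a y * v)" "0 \<le> L * u" "0 \<le> L * H * W * (a y * v)"
      using nonneg ay uv by auto
    then show ?thesis by (simp add: algebra_simps)
  qed
  finally show ?thesis by (simp add: double_phase_def u_def v_def)
qed

theorem lemma3p3:
  fixes \<Omega> :: "(real ^ 'd) set"
    and \<alpha> p q C\<^sub>p C\<^sub>q :: real
    and pf qf a :: "real ^ 'd \<Rightarrow> real"
  assumes "bounded \<Omega>" and "lipschitz_domain \<Omega>"
    and "0 < \<alpha>" and "\<alpha> \<le> 1"
    and "1 < p" and "p \<le> q"
    and "\<And>x. x \<in> closure \<Omega> \<Longrightarrow> 1 \<le> pf x"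
    and "\<And>x. x \<in> closure \<Omega> \<Longrightarrow> 1 \<le> qf x"
    and "\<And>x. x \<in> closure \<Omega> \<Longrightarrow> p \<le> pf x \<and> pf x \<le> qf x \<and> qf x \<le> q"
    and "\<And>x y. \<lbrakk>x \<in> closure \<Omega>; y \<in> closure \<Omega>; x \<noteq> y; norm (x - y) \<le> min (diameter \<Omega>) (1/2)\<rbrakk>
           \<Longrightarrow> \<bar>pf x - pf y\<bar> \<le> - (C\<^sub>p / ln (norm (x - y)))"
    and "\<And>x y. \<lbrakk>x \<in> closure \<Omega>; y \<in> closure \<Omega>; x \<noteq> y; norm (x - y) \<le> min (diameter \<Omega>) (1/2)\<rbrakk>
           \<Longrightarrow> \<bar>qf x - qf y\<bar> \<le> - (C\<^sub>q / ln (norm (x - y)))"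
    and "\<And>x. x \<in> closure \<Omega> \<Longrightarrow> 0 \<le> a x"
    and "a \<in> holder_space \<alpha> (closure \<Omega>)"
    and "q \<le> p + \<alpha> * max 1 (p / real CARD('d))"
  shows "\<forall>D>1. \<exists>M N. \<forall>\<gamma>\<in>{0<..<1/2}. \<forall>x.
           \<forall>y \<in> closure (ball x \<gamma>) \<inter> closure \<Omega>. \<forall>z \<in> closure (ball x \<gamma>) \<inter> closure \<Omega>.
           \<forall>\<xi>\<in>{0 .. D * \<gamma> powr (- min 1 (real CARD('d) / p))}.
             double_phase pf qf a z \<xi> \<le> M * double_phase pf qf a y \<xi> + N"
proof (intro allI impI)
  fix D :: real
  assume D: "1 < D"
  define S where "S = closure \<Omega>"
  have bS: "bounded S" using assms(1) by (simp add: S_def bounded_closure)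
  obtain H where H: "H \<ge> 0" "\<And>x y. x \<in> S \<Longrightarrow> y \<in> S \<Longrightarrow> \<bar>a x - a y\<bar> \<le> H * dist x y powr \<alpha>"
    using holder_space_const assms(13) S_def by blast
  obtain A where A: "A \<ge> 0" "\<And>x. x \<in> S \<Longrightarrow> a x \<le> A"
    using holder_space_bounded_above assms(3,13) bS S_def by (metis less_imp_le)
  \<comment> \<open>The reciprocal of this exponent is the maximum in the gap condition, which
    therefore reads \<open>q - p \<le> \<alpha> / \<sigma>\<close>.\<close>
  define \<sigma> where "\<sigma> = min 1 (real CARD('d) / p)"
  have \<sigma>: "0 < \<sigma>" "\<sigma> \<le> 1" using assms(5) by (auto simp: \<sigma>_def)
  have "max 1 (p / real CARD('d)) = 1 / \<sigma>"
    using assms(5) by (auto simp: \<sigma>_def min_def max_def field_simps)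
  with assms(14) have qp: "q - p \<le> \<alpha> / \<sigma>" by simp
  \<comment> \<open>The factor from \<open>powr_le_of_log_holder\<close> with
    \<open>E = 2 * D\<close>, kept as a function of the log-Hoelder constant because it serves both
    exponents.\<close>
  define K where "K C = exp (\<bar>C\<bar> * (ln (2 * D) / ln 2 + 1))" for C :: real
  have "ln (2 * D) \<ge> 0" using D by (intro ln_ge_zero) auto
  then have K1: "1 \<le> K C" for C by (simp add: K_def)
  define W where "W = 2 powr \<alpha> * D powr (\<alpha> / \<sigma>)"
  \<comment> \<open>\<open>M\<close> is the factor of \<open>double_phase_comparison\<close> for
    large \<open>\<xi>\<close>; \<open>N\<close> bounds the left side outright for
    \<open>\<xi> \<le> 4 * D\<close>.\<close>
  define M where "M = K C\<^sub>p + K C\<^sub>q + K C\<^sub>q * H * W"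
  define N where "N = (1 + A) * (4 * D) powr q"
  have M0: "0 \<le> M" and N0: "0 \<le> N"
    using K1[of "C\<^sub>p"] K1[of "C\<^sub>q"] H(1) A(1) by (auto simp: M_def N_def W_def)
  have main: "double_phase pf qf a z \<xi> \<le> M * double_phase pf qf a y \<xi> + N"
    if \<gamma>: "0 < \<gamma>" and y: "y \<in> closure (ball x \<gamma>)" "y \<in> S"
      and z: "z \<in> closure (ball x \<gamma>)" "z \<in> S"
      and \<xi>: "0 \<le> \<xi>" "\<xi> \<le> D * \<gamma> powr (- \<sigma>)" for \<gamma> x y z \<xi>
  \<comment> \<open>The threshold is chosen so that a larger \<open>\<xi>\<close> forces
    \<open>\<gamma> < 1/4\<close>. Then \<open>dist z y\<close> is below 1/2, where the log-Hoelder
    estimates apply.\<close>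
  proof (cases "\<xi> \<le> 4 * D")
    case True
    have "double_phase pf qf a z \<xi> \<le> N"
      unfolding N_def using True \<xi>(1) D assms(5) assms(9)[of z] assms(12)[of z] A(2)[of z] z(2)
      by (intro double_phase_le_of_bounded) (auto simp: S_def)
    moreover have "0 \<le> double_phase pf qf a y \<xi>"
      using assms(12) y(2) by (auto simp: double_phase_def S_def)
    ultimately show ?thesis using mult_nonneg_nonneg[OF M0] by (simp add: add_increasing)
  next
    case False
    have \<xi>1: "1 \<le> \<xi>" using False D by simp
    have "D * 4 < D * \<gamma> powr (- \<sigma>)" using False \<xi>(2) by linarith
    then have "\<gamma> powr (- \<sigma>) > 4" using D by simp
    have \<gamma>1: "\<gamma> < 1"
    proof (rule ccontr)
      assume "\<not> \<gamma> < 1"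
      then have "\<gamma> powr (- \<sigma>) \<le> 1 powr (- \<sigma>)"
        using \<sigma> by (intro powr_mono2') auto
      with \<open>\<gamma> powr (- \<sigma>) > 4\<close> show False by simp
    qed
    \<comment> \<open>For a base below 1 the smaller exponent gives the larger power, and \<sigma>
      is at most 1.\<close>
    have "\<gamma> powr (- \<sigma>) \<le> \<gamma> powr (- 1)"
      using \<gamma> \<gamma>1 \<sigma> by (intro powr_mono') auto
    then have inv: "\<gamma> powr (- \<sigma>) \<le> 1 / \<gamma>" using \<gamma> by (simp add: powr_minus divide_inverse)
    then have "4 < 1 / \<gamma>" using \<open>\<gamma> powr (- \<sigma>) > 4\<close> by linarith
    then have \<gamma>4: "\<gamma> < 1/4" using \<gamma> by (simp add: field_simps)
    have "dist x y \<le> \<gamma>" "dist x z \<le> \<gamma>" using y z \<gamma> by auto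
    then have r2: "dist z y \<le> 2 * \<gamma>" using dist_triangle2[of z y x] by (simp add: dist_commute)
    have \<xi>D: "\<xi> \<le> D / \<gamma>"
      using \<xi>(2) mult_left_mono[OF inv, of D] D by simp
    have ratio: "\<bar>\<xi>\<bar> powr f z \<le> K C * \<bar>\<xi>\<bar> powr f y"
      if f: "\<And>x y. \<lbrakk>x \<in> S; y \<in> S; x \<noteq> y; norm (x - y) \<le> min (diameter \<Omega>) (1/2)\<rbrakk>
        \<Longrightarrow> \<bar>f x - f y\<bar> \<le> - (C / ln (norm (x - y)))" for f C
    \<comment> \<open>The log-Hoelder estimate concerns distinct points; for equal ones
      \<open>1 \<le> K C\<close> is enough.\<close>
    proof (cases "z = y")
      case True
      then show ?thesis using K1[of C] by (simp add: mult_le_cancel_right1)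
    next
      case False
      define r where "r = norm (z - y)"
      have r: "0 < r" "r \<le> 2 * \<gamma>" using False r2 by (auto simp: r_def dist_norm)
      have "r \<le> diameter \<Omega>"
        using diameter_bounded_bound[OF bS z(2) y(2)] assms(1)
        by (simp add: r_def S_def dist_norm diameter_closure)
      then have fr: "\<bar>f z - f y\<bar> \<le> - (C / ln r)"
        using f[OF z(2) y(2) False] r \<gamma>4 by (simp add: r_def)
      \<comment> \<open>Since \<open>r \<le> 2 * \<gamma>\<close>, the bound on \<open>\<xi>\<close>
        takes the form \<open>E / r\<close> with \<open>E = 2 * D\<close>.\<close>
      have "D / \<gamma> \<le> 2 * D / r"
        using r \<gamma> D by (simp add: field_simps)
      then have "\<xi> powr f z \<le> K C * \<xi> powr f y"
        unfolding K_def using r \<gamma>4 D \<xi>1 \<xi>D by (intro powr_le_of_log_holder[OF fr]) auto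
      then show ?thesis using \<xi>1 by simp
    qed
    have "double_phase pf qf a z \<xi> \<le> M * double_phase pf qf a y \<xi>"
      unfolding M_def
    proof (rule double_phase_comparison)
      show "\<bar>\<xi>\<bar> powr pf z \<le> K C\<^sub>p * \<bar>\<xi>\<bar> powr pf y"
        using assms(10) by (intro ratio) (auto simp: S_def)
      show "\<bar>\<xi>\<bar> powr qf z \<le> K C\<^sub>q * \<bar>\<xi>\<bar> powr qf y"
        using assms(11) by (intro ratio) (auto simp: S_def)
      show "a z \<le> a y + H * dist z y powr \<alpha>" using H(2)[OF z(2) y(2)] by simp
      \<comment> \<open>The pointwise gap lies below the global gap \<open>q - p\<close>, because
        \<open>p \<le> pf y\<close> and \<open>qf y \<le> q\<close>.\<close>
      have "qf y - pf y \<le> \<alpha> / \<sigma>" using assms(9)[of y] y(2) qp by (simp add: S_def)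
      then show "dist z y powr \<alpha> * \<bar>\<xi>\<bar> powr qf y \<le> W * \<bar>\<xi>\<bar> powr pf y"
        using holder_gap_powr_le[of \<alpha> \<sigma> \<gamma> D "dist z y" \<xi> "qf y" "pf y"]
          assms(3) \<sigma> \<gamma> D r2 \<xi> \<xi>1 by (simp add: W_def)
    qed (use K1[of "C\<^sub>p"] K1[of "C\<^sub>q"] H(1) assms(12) y z in \<open>auto simp: W_def S_def\<close>)
    then show ?thesis using N0 by linarith
  qed
  show "\<exists>M N. \<forall>\<gamma>\<in>{0<..<1/2}. \<forall>x.
           \<forall>y \<in> closure (ball x \<gamma>) \<inter> closure \<Omega>. \<forall>z \<in> closure (ball x \<gamma>) \<inter> closure \<Omega>.
           \<forall>\<xi>\<in>{0 .. D * \<gamma> powr (- min 1 (real CARD('d) / p))}.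
             double_phase pf qf a z \<xi> \<le> M * double_phase pf qf a y \<xi> + N"
    unfolding S_def[symmetric] \<sigma>_def[symmetric]
    by (rule exI[of _ M], rule exI[of _ N]) (use main in auto)
qed

end
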